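(* Let $G$ be either the De Bruijn digraph $B(d,D)$ or the Kautz digraph $K(d,D)$, with vertex set $V$. Let $v\in V$, $w\in S_1(v)$, and let $1\le i\le D$. Assume that $S_{i}^\star(v) \cap S_{i-1}^{\star}(w)=\emptyset$. Then $S_{i}^\star(v)=S_{i}^\star(v)\cap S_{i}^{\star}(w)$, and so $$|S_{i}^\star(v) \cap S_{i}^{\star}(w)|=|S_{i}^\star(v)|=d^i-a_{i-1}d^{i-1}-\cdots -a_{1} d-a_{0},$$ where, for $0\le k\le i-1$, $a_k\in\{0,1\}$ and $a_k=1$ if and only if $S_{k,i}(v)\neq\emptyset$.
   Context: Let $d\ge 2$ and $D\ge 1$ be integers. The De Bruijn digraph $B(d,D)$ has as vertices all words $v=v_1v_2\cdots v_D$ over an alphabet $A$ with $|A|=d$; $v$ is adjacent to the $d$ vertices $v_2\cdots v_D v_{D+1}$, $v_{D+1}\in A$ (loops occur). The Kautz digraph $K(d,D)$ has as vertices all words $v=v_1v_2\cdots v_D$ over an alphabet $A$ with $|A|=d+1$ such that $v_k\ne v_{k+1}$ for $1\le k<D$; $v$ is adjacent to the $d$ vertices $v_2\cdots v_Dv_{D+1}$ with $v_{D+1}\in A$, $v_{D+1}\ne v_D$. Both are $d$-regular of diameter $D$. For $v\in V$ and $i\ge 0$, $S_i(v)$ is the set of vertices $u$ for which there is a walk of length exactly $i$ from $v$ to $u$ (so $S_1(v)$ is the set of vertices adjacent from $v$), and $S_i^\star(v)$ is the set of vertices at (directed) distance exactly $i$ from $v$. For integers $0\le k\le i\le D$: $S_{k,i}(v)=S_k(v)$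 if $S_k(v)\subseteq S_i(v)$ and, for all $j$ with $k<j<i$ such that $S_j(v)\subseteq S_i(v)$, we have $S_k(v)\not\subseteq S_j(v)$; otherwise $S_{k,i}(v)=\emptyset$. *)

theory Defs
  imports "Graph_Theory.Pair_Digraph" "Graph_Theory.Shortest_Path"
begin

text \<open>
  Words of length \<open>D\<close> over the alphabet \<open>A\<close> are lists; both digraphs are intended for \<open>D \<ge> 1\<close>.
  The parameter \<open>d\<close> is determined by the alphabet: \<open>B(d,D)\<close> is \<open>de_bruijn A D\<close> with \<open>card A = d\<close>,
  and \<open>K(d,D)\<close> is \<open>kautz A D\<close> with \<open>card A = d + 1\<close>.
\<close>

definition de_bruijn :: "'a set \<Rightarrow> nat \<Rightarrow> ('a list, 'a list \<times> 'a list) pre_digraph" where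
  "de_bruijn A D =
    (let V = {v. length v = D \<and> set v \<subseteq> A}
     in with_proj \<lparr>pverts = V, parcs = {(v, tl v @ [x]) | v x. v \<in> V \<and> x \<in> A}\<rparr>)"

definition kautz :: "'a set \<Rightarrow> nat \<Rightarrow> ('a list, 'a list \<times> 'a list) pre_digraph" where
  "kautz A D =
    (let V = {v. length v = D \<and> set v \<subseteq> A \<and> distinct_adj v}
     in with_proj
          \<lparr>pverts = V, parcs = {(v, tl v @ [x]) | v x. v \<in> V \<and> x \<in> A \<and> x \<noteq> last v}\<rparr>)"

definition walk_sphere :: "('a, 'b) pre_digraph \<Rightarrow> nat \<Rightarrow> 'a \<Rightarrow> 'a set" where
  "walk_sphere G i v = {u. \<exists>p. pre_digraph.awalk G v p u \<and> length p = i}"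

text \<open>The directed distance is the shortest-path cost for unit arc weights.\<close>

definition dist_sphere :: "('a, 'b) pre_digraph \<Rightarrow> nat \<Rightarrow> 'a \<Rightarrow> 'a set" where
  "dist_sphere G i v = {u \<in> verts G. wf_digraph.\<mu> G (\<lambda>_. 1) v u = ereal (real i)}"

definition walk_sphere_in :: "('a, 'b) pre_digraph \<Rightarrow> nat \<Rightarrow> nat \<Rightarrow> 'a \<Rightarrow> 'a set" where
  "walk_sphere_in G k i v =
    (if walk_sphere G k v \<subseteq> walk_sphere G i v \<and>
        (\<forall>j. k < j \<and> j < i \<and> walk_sphere G j v \<subseteq> walk_sphere G i v \<longrightarrow>
             \<not> walk_sphere G k v \<subseteq> walk_sphere G j v)
     then walk_sphere G k v else {})"

lemma set_tl_subset: "set v \<subseteq> A \<Longrightarrow> set (tl v) \<subseteq> A"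
  by (cases v) simp_all

lemma wf_digraph_de_bruijn:
  assumes "D \<ge> 1"
  shows "wf_digraph (de_bruijn A D)"
proof
  fix e assume "e \<in> arcs (de_bruijn A D)"
  then obtain v x where e: "e = (v, tl v @ [x])" "length v = D" "set v \<subseteq> A" "x \<in> A"
    unfolding de_bruijn_def Let_def by force
  from e show "tail (de_bruijn A D) e \<in> verts (de_bruijn A D)"
    by (simp add: de_bruijn_def)
  from e assms set_tl_subset[of v A] show "head (de_bruijn A D) e \<in> verts (de_bruijn A D)"
    by (simp add: de_bruijn_def)
qed

lemma wf_digraph_kautz:
  assumes "D \<ge> 1"
  shows "wf_digraph (kautz A D)"
proof
  fix e assume "e \<in> arcs (kautz A D)"
  then obtain v x where e: "e = (v, tl v @ [x])" "length v = D" "set v \<subseteq> A" "distinct_adj v"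
      "x \<in> A" "x \<noteq> last v"
    unfolding kautz_def Let_def by force
  from e show "tail (kautz A D) e \<in> verts (kautz A D)"
    by (simp add: kautz_def)
  have "distinct_adj (tl v @ [x])"
    using e(4,6) by (cases v) (auto simp: distinct_adj_append_iff distinct_adj_Cons)
  with e assms set_tl_subset[of v A] show "head (kautz A D) e \<in> verts (kautz A D)"
    by (simp add: kautz_def)
qed

lemma (in wf_digraph) walk_sphere_1: "walk_sphere G 1 v = {u. v \<rightarrow>\<^bsub>G\<^esub> u}"
proof (intro set_eqI iffI; clarsimp)
  fix u assume "u \<in> walk_sphere G (Suc 0) v"
  then obtain e where "awalk v [e] u"
    by (auto simp: walk_sphere_def length_Suc_conv)
  then show "v \<rightarrow>\<^bsub>G\<^esub> u"
    by (auto simp: awalk_Cons_iff awalk_Nil_iff intro: in_arcs_imp_in_arcs_ends)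
next
  fix u assume "v \<rightarrow>\<^bsub>G\<^esub> u"
  then obtain e where "e \<in> arcs G" "tail G e = v" "head G e = u"
    by (auto simp: arcs_ends_conv)
  then have "awalk v [e] u"
    by (auto simp: awalk_Cons_iff awalk_Nil_iff)
  then show "u \<in> walk_sphere G (Suc 0) v"
    by (force simp: walk_sphere_def)
qed

lemma (in wf_digraph) dist_sphere_iff:
  "u \<in> dist_sphere G i v \<longleftrightarrow> u \<in> walk_sphere G i v \<and> (\<forall>j<i. u \<notin> walk_sphere G j v)"
proof -
  have cost: "awalk_cost (\<lambda>_. 1) p = real (length p)" for p :: "'b awalk"
    by (induction p) auto
  have mu: "\<mu> (\<lambda>_. 1) v u = (INF p\<in>{p. awalk v p u}. ereal (real (length p)))"
    by (simp add: \<mu>_def cost)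
  show ?thesis
  proof (cases "\<exists>p. awalk v p u")
    case False
    then have "{p. awalk v p u} = {}"
      by blast
    then have "\<mu> (\<lambda>_. 1) v u = \<infinity>"
      unfolding mu by (simp add: top_ereal_def)
    then have "u \<notin> dist_sphere G i v"
      by (simp add: dist_sphere_def)
    moreover from False have "u \<notin> walk_sphere G i v"
      by (simp add: walk_sphere_def)
    ultimately show ?thesis
      by simp
  next
    case True
    then obtain q where q: "awalk v q u" and min: "\<And>p. awalk v p u \<Longrightarrow> length q \<le> length p"
      using ex_has_least_nat[of "\<lambda>p. awalk v p u" _ length] by metis
    have "\<mu> (\<lambda>_. 1) v u = ereal (real (length q))"
      unfolding mu
    proof (rule antisym)
      show "(INF p\<in>{p. awalk v p u}. ereal (real (length p))) \<le> ereal (real (length q))"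
        using q by (intro INF_lower) simp
      show "ereal (real (length q)) \<le> (INF p\<in>{p. awalk v p u}. ereal (real (length p)))"
        using min by (intro INF_greatest) simp
    qed
    moreover have "u \<in> verts G"
      using q by (rule awalk_last_in_verts)
    ultimately have "u \<in> dist_sphere G i v \<longleftrightarrow> i = length q"
      by (auto simp: dist_sphere_def)
    also have "\<dots> \<longleftrightarrow> u \<in> walk_sphere G i v \<and> (\<forall>j<i. u \<notin> walk_sphere G j v)"
    proof
      assume "i = length q"
      then show "u \<in> walk_sphere G i v \<and> (\<forall>j<i. u \<notin> walk_sphere G j v)"
        using q min unfolding walk_sphere_def by (auto simp: not_less[symmetric])
    next
      assume *: "u \<in> walk_sphere G i v \<and> (\<forall>j<i. u \<notin> walk_sphere G j v)"
      moreover have "u \<in> walk_sphere G (length q) v"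
        using q unfolding walk_sphere_def by blast
      ultimately have "i \<le> length q"
        using not_less by blast
      moreover have "length q \<le> i"
        using * min unfolding walk_sphere_def by blast
      ultimately show "i = length q"
        by simp
    qed
    finally show ?thesis .
  qed
qed

end

theory Submission
  imports Defs
begin

text \<open>
  For \<open>i \<le> D\<close> the walks of length \<open>i\<close> from \<open>v\<close> delete the first \<open>i\<close> letters of \<open>v\<close> and append
  \<open>i\<close> new ones, so \<open>S\<^sub>i(v)\<close> consists of the vertices \<open>drop i v @ y\<close>, and it has \<open>d ^ i\<close> elements.
  Whether a vertex belongs to \<open>S\<^sub>i(v)\<close> is decided by its first \<open>max 1 (D - i)\<close> letters, while for
  \<open>j < i\<close> all members of \<open>S\<^sub>j(v)\<close> share their first \<open>D - j\<close> letters. Hence \<open>S\<^sub>j(v)\<close> is either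
  contained in \<open>S\<^sub>i(v)\<close> or disjoint from it (lemma \<open>walk_sphere_laminar\<close>).

  The cardinality formula follows from laminarity and \<open>|S\<^sub>k(v)| = d ^ k\<close>: what must be removed from \<open>S\<^sub>i(v)\<close>
  to obtain \<open>S\<^sub>i\<^sup>\<star>(v)\<close> is the union of the sets \<open>S\<^sub>j(v) \<subseteq> S\<^sub>i(v)\<close> with \<open>j < i\<close>, and this is the
  disjoint union of the maximal ones, which are the nonempty \<open>S\<^sub>k\<^sub>,\<^sub>i(v)\<close>
  (lemma \<open>card_laminar_difference\<close>).

  For the first claim, \<open>S\<^sub>i\<^sub>-\<^sub>1(w)\<close> has \<open>d ^ (i - 1) > 1 + d + \<dots> + d ^ (i - 2)\<close> elements and so
  contains some \<open>u\<close> lying in no \<open>S\<^sub>j(v)\<close> with \<open>j < i - 1\<close>. If \<open>u\<close> were not in \<open>S\<^sub>i\<^sub>-\<^sub>1(v)\<close> either, it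
  would have distance \<open>i\<close> from \<open>v\<close> and \<open>i - 1\<close> from \<open>w\<close>, against the assumption. So \<open>S\<^sub>i\<^sub>-\<^sub>1(v)\<close>
  and \<open>S\<^sub>i\<^sub>-\<^sub>1(w)\<close> meet, which forces \<open>v\<close> and \<open>w\<close> to agree after their first \<open>i - 1\<close> letters, and
  then \<open>S\<^sub>i(v) = S\<^sub>i(w)\<close>. A vertex of \<open>S\<^sub>i\<^sup>\<star>(v)\<close> is thus reachable from \<open>w\<close> in \<open>i\<close> steps; it cannot
  be reached from \<open>w\<close> in fewer than \<open>i - 1\<close> steps because \<open>w\<close> is adjacent from \<open>v\<close>, nor in \<open>i - 1\<close>
  steps by the assumption.
\<close>

section \<open>Laminar sequences of sets\<close>

text \<open>
  The index set on the right selects the maximal members of the sequence inside \<open>S i\<close>; a set that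
  occurs several times is selected at its largest index only. Laminarity makes the selected sets
  pairwise disjoint, and every \<open>S j\<close> inside \<open>S i\<close> lies in a selected one.
\<close>

lemma card_laminar_difference:
  fixes S :: "nat \<Rightarrow> 'b set" and i :: nat
  defines "M \<equiv> {k. k < i \<and> S k \<subseteq> S i \<and> (\<forall>j. k < j \<and> j < i \<and> S j \<subseteq> S i \<longrightarrow> \<not> S k \<subseteq> S j)}"
  assumes lam: "\<And>j k. j < k \<Longrightarrow> k \<le> i \<Longrightarrow> S j \<inter> S k \<noteq> {} \<Longrightarrow> S j \<subseteq> S k"
    and fin: "finite (S i)"
  shows "int (card (S i - (\<Union>j<i. S j))) = int (card (S i)) - (\<Sum>k\<in>M. int (card (S k)))"
proof -
  have M: "k \<in> M \<longleftrightarrow> k < i \<and> S k \<subseteq> S i \<and> (\<forall>j. k < j \<and> j < i \<and> S j \<subseteq> S i \<longrightarrow> \<not> S k \<subseteq> S j)"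
    for k by (simp add: M_def)
  have finM: "finite M"
    by (rule finite_subset[of _ "{..<i}"]) (auto simp: M)
  have cover: "S i \<inter> (\<Union>j<i. S j) = (\<Union>k\<in>M. S k)"
  proof
    show "(\<Union>k\<in>M. S k) \<subseteq> S i \<inter> (\<Union>j<i. S j)"
      by (auto simp: M)
    show "S i \<inter> (\<Union>j<i. S j) \<subseteq> (\<Union>k\<in>M. S k)"
    proof
      fix x assume x: "x \<in> S i \<inter> (\<Union>j<i. S j)"
      \<comment> \<open>The last index below \<open>i\<close> whose set contains \<open>x\<close> is a selected one.\<close>
      define k where "k = Max {j. j < i \<and> x \<in> S j}"
      have "k \<in> {j. j < i \<and> x \<in> S j}"
        unfolding k_def using x by (intro Max_in) auto
      moreover have "j \<le> k" if "j < i" "x \<in> S j" for j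
        unfolding k_def using that by (intro Max_ge) auto
      moreover have "S k \<subseteq> S i"
        using calculation(1) x by (intro lam) auto
      ultimately have "k \<in> M" "x \<in> S k"
        unfolding M by (auto simp: not_le[symmetric])
      then show "x \<in> (\<Union>k\<in>M. S k)"
        by blast
    qed
  qed
  have disj: "S j \<inter> S k = {}" if "j \<in> M" "k \<in> M" "j \<noteq> k" for j k
    using that
  proof (induction j k rule: linorder_wlog)
    case (le j k)
    then show ?case
      using lam[of j k] unfolding M by (metis le_neq_implies_less less_imp_le)
  qed (simp add: Int_commute)
  have finS: "finite (S k)" if "k \<in> M" for k
    using that fin unfolding M by (blast intro: finite_subset)
  have "card (S i - (\<Union>j<i. S j)) = card (S i - (\<Union>k\<in>M. S k))"
    unfolding cover[symmetric] by (rule arg_cong[of _ _ card]) blast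
  moreover have "(\<Union>k\<in>M. S k) \<subseteq> S i"
    using cover by blast
  ultimately have "int (card (S i - (\<Union>j<i. S j))) = int (card (S i)) - int (card (\<Union>k\<in>M. S k))"
    using fin by (simp add: card_Diff_subset card_mono finite_subset of_nat_diff)
  also have "card (\<Union>k\<in>M. S k) = (\<Sum>k\<in>M. card (S k))"
    using finM finS disj by (intro card_UN_disjoint) auto
  finally show ?thesis
    by simp
qed

lemma sum_powers_less_power:
  assumes "(d::nat) \<ge> 2"
  shows "(\<Sum>j<n. d ^ j) < d ^ n"
proof (induction n)
  case (Suc n)
  have "(\<Sum>j<Suc n. d ^ j) < 2 * d ^ n"
    using Suc.IH by simp
  also have "\<dots> \<le> d ^ Suc n"
    using assms by simp
  finally show ?case .
qed simp

section \<open>Walk spheres and distance spheres\<close>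

lemma (in wf_digraph) walk_sphere_0:
  assumes "v \<in> verts G"
  shows "walk_sphere G 0 v = {v}"
  using assms by (auto simp: walk_sphere_def awalk_Nil_iff)

lemma (in wf_digraph) walk_sphere_Suc:
  "walk_sphere G (Suc i) v = (\<Union>w\<in>{w. v \<rightarrow>\<^bsub>G\<^esub> w}. walk_sphere G i w)"
proof (intro set_eqI iffI)
  fix u assume "u \<in> walk_sphere G (Suc i) v"
  then obtain e p where "awalk v (e # p) u" "length p = i"
    by (auto simp: walk_sphere_def length_Suc_conv)
  then show "u \<in> (\<Union>w\<in>{w. v \<rightarrow>\<^bsub>G\<^esub> w}. walk_sphere G i w)"
    by (auto simp: awalk_Cons_iff walk_sphere_def intro: in_arcs_imp_in_arcs_ends)
next
  fix u assume "u \<in> (\<Union>w\<in>{w. v \<rightarrow>\<^bsub>G\<^esub> w}. walk_sphere G i w)"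
  then obtain e p where "e \<in> arcs G" "tail G e = v" "awalk (head G e) p u" "length p = i"
    by (auto simp: walk_sphere_def arcs_ends_conv)
  then have "awalk v (e # p) u" "length (e # p) = Suc i"
    by (auto simp: awalk_Cons_iff)
  then show "u \<in> walk_sphere G (Suc i) v"
    unfolding walk_sphere_def by blast
qed

lemma (in wf_digraph) dist_sphere_eq_Diff:
  "dist_sphere G i v = walk_sphere G i v - (\<Union>j<i. walk_sphere G j v)"
  by (auto simp: dist_sphere_iff)

text \<open>Prefixing the arc \<open>v \<rightarrow> w\<close> would turn a shorter walk from \<open>w\<close> into one from \<open>v\<close>.\<close>

lemma (in wf_digraph) dist_sphere_successor:
  assumes "v \<rightarrow>\<^bsub>G\<^esub> w" "u \<in> walk_sphere G i w" "u \<in> dist_sphere G (Suc i) v"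
  shows "u \<in> dist_sphere G i w"
  using assms by (fastforce simp: dist_sphere_iff walk_sphere_Suc)

section \<open>Digraphs of words with a local adjacency rule\<close>

text \<open>
  The De Bruijn and Kautz digraphs differ only in which letters may follow a given letter:
  \<open>R a x\<close> says that \<open>x\<close> may follow \<open>a\<close>. It is always true for De Bruijn digraphs and is
  inequality for Kautz digraphs.
\<close>

locale word_digraph =
  fixes A :: "'a set" and R :: "'a \<Rightarrow> 'a \<Rightarrow> bool" and d D :: nat
  assumes finite_alphabet: "finite A"
    and regular: "a \<in> A \<Longrightarrow> card {x \<in> A. R a x} = d"
    and degree_pos: "d \<ge> 1"
    and length_pos: "D \<ge> 1"
begin

definition words :: "'a list set" where
  "words = {v. length v = D \<and> set v \<subseteq> A \<and> successively R v}"

definition G :: "('a list, 'a list \<times> 'a list) pre_digraph" where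
  "G = with_proj
     \<lparr>pverts = words, parcs = {(v, tl v @ [x]) | v x. v \<in> words \<and> x \<in> A \<and> R (last v) x}\<rparr>"

definition extensions :: "nat \<Rightarrow> 'a \<Rightarrow> 'a list set" where
  "extensions i a = {y. length y = i \<and> set y \<subseteq> A \<and> successively R (a # y)}"

lemma words_nonempty: "v \<in> words \<Longrightarrow> v \<noteq> []"
  using length_pos by (auto simp: words_def)

lemma last_in_alphabet: "v \<in> words \<Longrightarrow> last v \<in> A"
  using last_in_set[OF words_nonempty] by (auto simp: words_def)

lemma append_letter_in_words:
  assumes "v \<in> words" "x \<in> A" "R (last v) x"
  shows "tl v @ [x] \<in> words"
  using assms words_nonempty[OF assms(1)] length_pos
  by (cases v) (auto simp: words_def successively_append_iff successively_Cons split: if_splits)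

lemma verts_G: "verts G = words"
  by (simp add: G_def)

lemma adj_iff: "v \<rightarrow>\<^bsub>G\<^esub> w \<longleftrightarrow> v \<in> words \<and> (\<exists>x\<in>A. R (last v) x \<and> w = tl v @ [x])"
  by (auto simp: G_def arcs_ends_def arc_to_ends_def)

sublocale wf_digraph G
proof
  fix e assume "e \<in> arcs G"
  then show "tail G e \<in> verts G" "head G e \<in> verts G"
    by (auto simp: G_def intro: append_letter_in_words)
qed

lemma extensions_0: "extensions 0 a = {[]}"
  by (auto simp: extensions_def)

lemma extensions_Suc:
  "extensions (Suc i) a = (\<lambda>(x, y). x # y) ` (SIGMA x:{x \<in> A. R a x}. extensions i x)"
proof (rule set_eqI)
  fix ys
  show "ys \<in> extensions (Suc i) a \<longleftrightarrow>
      ys \<in> (\<lambda>(x, y). x # y) ` (SIGMA x:{x \<in> A. R a x}. extensions i x)"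
    by (cases ys) (auto simp: extensions_def)
qed

lemma finite_card_extensions:
  assumes "a \<in> A"
  shows "finite (extensions i a) \<and> card (extensions i a) = d ^ i"
  using assms
proof (induction i arbitrary: a)
  case 0
  then show ?case by (simp add: extensions_0)
next
  case (Suc i)
  have inj: "inj_on (\<lambda>(x, y). x # y) B" for B :: "('a \<times> 'a list) set"
    by (auto simp: inj_on_def)
  show ?case
    using Suc finite_alphabet
    by (auto simp: extensions_Suc card_image[OF inj] card_SigmaI regular
        intro!: finite_imageI finite_SigmaI)
qed

lemma walk_sphere_extensions:
  assumes "v \<in> words"
  shows "walk_sphere G i v = (\<lambda>y. drop i (v @ y)) ` extensions i (last v)"
  using assms
proof (induction i arbitrary: v)
  case 0
  then show ?case by (simp add: walk_sphere_0 verts_G extensions_0)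
next
  case (Suc i)
  obtain b v' where v: "v = b # v'"
    using words_nonempty[OF Suc.prems] by (cases v) auto
  have "walk_sphere G (Suc i) v =
      (\<Union>x\<in>{x \<in> A. R (last v) x}. walk_sphere G i (tl v @ [x]))"
    using Suc.prems by (auto simp: walk_sphere_Suc adj_iff)
  also have "\<dots> = (\<Union>x\<in>{x \<in> A. R (last v) x}. (\<lambda>y. drop i (v' @ x # y)) ` extensions i x)"
    using Suc.IH[OF append_letter_in_words[OF Suc.prems]]
    by (intro SUP_cong refl) (simp add: v del: drop_append)
  also have "\<dots> = (\<lambda>y. drop (Suc i) (v @ y)) ` extensions (Suc i) (last v)"
    by (auto simp: extensions_Suc v image_UN image_image Sigma_def simp del: drop_append)
  finally show ?case .
qed

text \<open>For \<open>i \<le> D\<close> no appended letter has been deleted again.\<close>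

lemma walk_sphere_drop_append:
  assumes "v \<in> words" "i \<le> D"
  shows "walk_sphere G i v = (\<lambda>y. drop i v @ y) ` extensions i (last v)"
  using assms by (simp add: walk_sphere_extensions words_def)

lemma finite_walk_sphere: "v \<in> words \<Longrightarrow> finite (walk_sphere G i v)"
  by (simp add: walk_sphere_extensions finite_card_extensions last_in_alphabet)

lemma card_walk_sphere:
  assumes "v \<in> words" "i \<le> D"
  shows "card (walk_sphere G i v) = d ^ i"
  using assms by (simp add: walk_sphere_drop_append card_image inj_on_def
      finite_card_extensions last_in_alphabet)

lemma walk_sphere_nonempty:
  assumes "v \<in> words" "i \<le> D"
  shows "walk_sphere G i v \<noteq> {}"
  using card_walk_sphere[OF assms] degree_pos by auto

lemma walk_sphere_subset_words: "walk_sphere G i v \<subseteq> words"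
  using verts_G by (auto simp: walk_sphere_def)

text \<open>
  For \<open>i = D\<close> nothing of \<open>v\<close> is left in \<open>u\<close>, but the rule for consecutive letters still links
  the last letter of \<open>v\<close> to the first letter of \<open>u\<close>.
\<close>

lemma in_walk_sphere_iff:
  assumes "v \<in> words" "i \<le> D"
  shows "u \<in> walk_sphere G i v \<longleftrightarrow>
    u \<in> words \<and> take (D - i) u = drop i v \<and> (i = D \<longrightarrow> R (last v) (hd u))"
proof
  assume u: "u \<in> walk_sphere G i v"
  then obtain y where y: "u = drop i v @ y" "y \<in> extensions i (last v)"
    using assms by (auto simp: walk_sphere_drop_append)
  have "length v = D"
    using assms by (simp add: words_def)
  with y u length_pos walk_sphere_subset_words
  show "u \<in> words \<and> take (D - i) u = drop i v \<and> (i = D \<longrightarrow> R (last v) (hd u))"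
    by (cases y) (auto simp: extensions_def)
next
  assume u: "u \<in> words \<and> take (D - i) u = drop i v \<and> (i = D \<longrightarrow> R (last v) (hd u))"
  define y where "y = drop (D - i) u"
  have uy: "u = drop i v @ y"
    using u by (metis append_take_drop_id y_def)
  have v: "length v = D"
    using assms by (simp add: words_def)
  have "successively R (last v # y)"
  proof (cases "i = D")
    case True
    then show ?thesis
      using u uy v by (auto simp: words_def successively_Cons)
  next
    case False
    then have "drop i v \<noteq> []" "last (drop i v) = last v"
      using assms(2) v by auto
    then show ?thesis
      using u uy by (cases y) (auto simp: words_def successively_append_iff)
  qed
  moreover have "set y \<subseteq> A" "length y = i"
    using u assms v uy by (auto simp: words_def)
  ultimately have "y \<in> extensions i (last v)"
    by (simp add: extensions_def)
  with uy show "u \<in> walk_sphere G i v"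
    using assms by (auto simp: walk_sphere_drop_append)
qed

lemma walk_sphere_laminar:
  assumes v: "v \<in> words" and ji: "j < i" "i \<le> D"
    and meet: "walk_sphere G j v \<inter> walk_sphere G i v \<noteq> {}"
  shows "walk_sphere G j v \<subseteq> walk_sphere G i v"
proof
  fix u' assume u': "u' \<in> walk_sphere G j v"
  obtain u where u: "u \<in> walk_sphere G j v" "u \<in> walk_sphere G i v"
    using meet by blast
  have pre: "take (D - j) u' = take (D - j) u"
    using u(1) u' v ji by (simp add: in_walk_sphere_iff)
  have "take (D - i) u' = take (D - i) (take (D - j) u')"
    using ji by (simp add: min_def)
  also have "\<dots> = take (D - i) u"
    using ji unfolding pre by (simp add: min_def)
  finally have "take (D - i) u' = take (D - i) u" .
  moreover have "hd u' = hd u"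
    using pre ji by (metis hd_take zero_less_diff order_less_le_trans)
  ultimately show "u' \<in> walk_sphere G i v"
    using u(2) u' v ji by (simp add: in_walk_sphere_iff)
qed

text \<open>The bound \<open>i < D\<close> keeps at least the last letters of \<open>v\<close> and \<open>w\<close> in a common vertex.\<close>

lemma walk_sphere_Suc_eq_if_meet:
  assumes vw: "v \<in> words" "w \<in> words" and i: "i < D"
    and meet: "walk_sphere G i v \<inter> walk_sphere G i w \<noteq> {}"
  shows "walk_sphere G (Suc i) v = walk_sphere G (Suc i) w"
proof -
  have "drop i v = drop i w"
    using meet vw i by (auto simp: in_walk_sphere_iff)
  moreover have "length v = D" "length w = D"
    using vw by (auto simp: words_def)
  ultimately have "drop (Suc i) v = drop (Suc i) w" "last v = last w"
    using i by (metis drop_Suc tl_drop, metis last_drop)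
  with vw i show ?thesis
    by (simp add: walk_sphere_drop_append)
qed

section \<open>Spheres around adjacent vertices\<close>

text \<open>The spheres of radius below \<open>i\<close> are jointly too small to contain one of radius \<open>i\<close>.\<close>

lemma ex_in_walk_sphere_not_smaller:
  assumes "d \<ge> 2" "v \<in> words" "w \<in> words" "i \<le> D"
  shows "\<exists>u\<in>walk_sphere G i w. \<forall>j<i. u \<notin> walk_sphere G j v"
proof -
  have "card (\<Union>j<i. walk_sphere G j v) \<le> (\<Sum>j<i. card (walk_sphere G j v))"
    by (rule card_UN_le) simp
  also have "\<dots> = (\<Sum>j<i. d ^ j)"
    using assms by (intro sum.cong) (auto simp: card_walk_sphere)
  also have "\<dots> < card (walk_sphere G i w)"
    using assms by (simp add: card_walk_sphere sum_powers_less_power)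
  finally have "\<not> walk_sphere G i w \<subseteq> (\<Union>j<i. walk_sphere G j v)"
    using assms finite_walk_sphere by (metis card_mono finite_UN_I finite_lessThan not_le)
  then show ?thesis
    by blast
qed

text \<open>
  The disjointness assumption is used twice: to make the spheres of radius \<open>i\<close> around \<open>v\<close> and
  \<open>w\<close> meet, hence those of radius \<open>i + 1\<close> coincide, and to exclude that a vertex at distance
  \<open>i + 1\<close> from \<open>v\<close> is closer to \<open>w\<close>.
\<close>

lemma dist_sphere_subset_successor:
  assumes d: "d \<ge> 2" and vw: "v \<rightarrow>\<^bsub>G\<^esub> w" and i: "i < D"
    and disj: "dist_sphere G (Suc i) v \<inter> dist_sphere G i w = {}"
  shows "dist_sphere G (Suc i) v \<subseteq> dist_sphere G (Suc i) w"
proof -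
  have words: "v \<in> words" "w \<in> words"
    using vw append_letter_in_words by (auto simp: adj_iff)
  obtain u where u: "u \<in> walk_sphere G i w" "\<forall>j<i. u \<notin> walk_sphere G j v"
    using ex_in_walk_sphere_not_smaller[OF d words less_imp_le[OF i]] by blast
  have "u \<in> walk_sphere G i v"
  proof (rule ccontr)
    assume "u \<notin> walk_sphere G i v"
    with u vw have "u \<in> dist_sphere G (Suc i) v"
      by (auto simp: dist_sphere_iff walk_sphere_Suc less_Suc_eq)
    with dist_sphere_successor[OF vw u(1)] disj show False
      by blast
  qed
  with u(1) have eq: "walk_sphere G (Suc i) v = walk_sphere G (Suc i) w"
    using walk_sphere_Suc_eq_if_meet[OF words i] by blast
  show ?thesis
  proof
    fix u assume u: "u \<in> dist_sphere G (Suc i) v"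
    have "u \<notin> walk_sphere G j w" if "j < Suc i" for j
    proof (cases "j = i")
      case True
      with dist_sphere_successor[OF vw _ u] u disj show ?thesis
        by blast
    next
      case False
      with that have "u \<notin> walk_sphere G (Suc j) v"
        using u by (auto simp: dist_sphere_iff)
      with vw show ?thesis
        by (auto simp: walk_sphere_Suc)
    qed
    with u eq show "u \<in> dist_sphere G (Suc i) w"
      by (simp add: dist_sphere_iff)
  qed
qed

lemma walk_sphere_in_nonempty_iff:
  assumes "v \<in> words" "k \<le> D"
  shows "walk_sphere_in G k i v \<noteq> {} \<longleftrightarrow> walk_sphere G k v \<subseteq> walk_sphere G i v \<and>
    (\<forall>j. k < j \<and> j < i \<and> walk_sphere G j v \<subseteq> walk_sphere G i v \<longrightarrow>
      \<not> walk_sphere G k v \<subseteq> walk_sphere G j v)"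
  using walk_sphere_nonempty[OF assms] by (simp add: walk_sphere_in_def)

lemma card_dist_sphere:
  assumes v: "v \<in> words" and i: "i \<le> D"
  shows "int (card (dist_sphere G i v)) =
    int d ^ i - (\<Sum>k<i. of_bool (walk_sphere_in G k i v \<noteq> {}) * int d ^ k)"
proof -
  define M where "M = {k. k < i \<and> walk_sphere_in G k i v \<noteq> {}}"
  have "M = {k. k < i \<and> walk_sphere G k v \<subseteq> walk_sphere G i v \<and>
      (\<forall>j. k < j \<and> j < i \<and> walk_sphere G j v \<subseteq> walk_sphere G i v \<longrightarrow>
        \<not> walk_sphere G k v \<subseteq> walk_sphere G j v)}"
    unfolding M_def using i by (intro Collect_cong conj_cong refl walk_sphere_in_nonempty_iff v) simp
  then have "int (card (dist_sphere G i v)) =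
      int (card (walk_sphere G i v)) - (\<Sum>k\<in>M. int (card (walk_sphere G k v)))"
    using card_laminar_difference[of i "\<lambda>j. walk_sphere G j v"]
      walk_sphere_laminar[OF v] finite_walk_sphere[OF v] i
    by (simp add: dist_sphere_eq_Diff)
  also have "(\<Sum>k\<in>M. int (card (walk_sphere G k v))) = (\<Sum>k\<in>M. int d ^ k)"
    using v i by (intro sum.cong) (auto simp: M_def card_walk_sphere)
  also have "\<dots> = (\<Sum>k<i. of_bool (walk_sphere_in G k i v \<noteq> {}) * int d ^ k)"
    by (rule sum.mono_neutral_cong_left) (auto simp: M_def)
  finally show ?thesis
    using v i by (simp add: card_walk_sphere)
qed

end

section \<open>De Bruijn and Kautz digraphs\<close>

lemma word_digraph_de_bruijn:
  assumes "card A \<ge> 1" "D \<ge> 1"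
  shows "word_digraph A (\<lambda>_ _. True) (card A) D"
    and "de_bruijn A D = word_digraph.G A (\<lambda>_ _. True) D"
proof -
  show wd: "word_digraph A (\<lambda>_ _. True) (card A) D"
    using assms by unfold_locales (auto intro: card_ge_0_finite)
  have "successively (\<lambda>_ _. True) v" for v :: "'a list"
    by (simp add: successively_conv_nth)
  then show "de_bruijn A D = word_digraph.G A (\<lambda>_ _. True) D"
    by (simp add: de_bruijn_def word_digraph.G_def[OF wd] word_digraph.words_def[OF wd])
qed

lemma word_digraph_kautz:
  assumes "card A = d + 1" "d \<ge> 1" "D \<ge> 1"
  shows "word_digraph A (\<noteq>) d D"
    and "kautz A D = word_digraph.G A (\<noteq>) D"
proof -
  have "finite A"
    using assms(1) by (auto intro: card_ge_0_finite)
  moreover have "card {x \<in> A. a \<noteq> x} = d" if "a \<in> A" for a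
  proof -
    have "{x \<in> A. a \<noteq> x} = A - {a}"
      by blast
    then show ?thesis
      using that assms(1) by simp
  qed
  ultimately show wd: "word_digraph A (\<noteq>) d D"
    using assms by unfold_locales
  show "kautz A D = word_digraph.G A (\<noteq>) D"
    by (simp add: kautz_def word_digraph.G_def[OF wd] word_digraph.words_def[OF wd]
        distinct_adj_def eq_commute[of _ "last _"])
qed

theorem theorem2:
  fixes A :: "'a set" and d D i :: nat
    and G :: "('a list, 'a list \<times> 'a list) pre_digraph"
    and v w :: "'a list"
  assumes "d \<ge> 2" and "D \<ge> 1"
    and "(card A = d \<and> G = de_bruijn A D) \<or> (card A = d + 1 \<and> G = kautz A D)"
    and "v \<in> verts G" and "w \<in> walk_sphere G 1 v"
    and "1 \<le> i" and "i \<le> D"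
    and "dist_sphere G i v \<inter> dist_sphere G (i - 1) w = {}"
  shows "dist_sphere G i v = dist_sphere G i v \<inter> dist_sphere G i w \<and>
    card (dist_sphere G i v \<inter> dist_sphere G i w) = card (dist_sphere G i v) \<and>
    (\<exists>a :: nat \<Rightarrow> int.
      (\<forall>k<i. a k \<in> {0, 1} \<and> (a k = 1 \<longleftrightarrow> walk_sphere_in G k i v \<noteq> {})) \<and>
      int (card (dist_sphere G i v)) = int d ^ i - (\<Sum>k<i. a k * int d ^ k))"
proof -
  obtain R where wd: "word_digraph A R d D" and G: "G = word_digraph.G A R D"
  proof -
    consider "card A = d" "G = de_bruijn A D" | "card A = d + 1" "G = kautz A D"
      using assms(3) by blast
    then show ?thesis
      using that word_digraph_de_bruijn[of A D] word_digraph_kautz[of A d D] assms(1,2)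
      by cases auto
  qed
  interpret W: word_digraph A R d D
    by (fact wd)
  have v: "v \<in> W.words" and vw: "v \<rightarrow>\<^bsub>W.G\<^esub> w"
    using assms(4,5) unfolding G W.verts_G W.walk_sphere_1 by simp_all
  have "dist_sphere G i v \<subseteq> dist_sphere G i w"
    using W.dist_sphere_subset_successor[OF assms(1) vw, of "i - 1"] assms(6-8)
    unfolding G by simp
  then have eq: "dist_sphere G i v = dist_sphere G i v \<inter> dist_sphere G i w"
    by blast
  moreover have "int (card (dist_sphere G i v)) =
      int d ^ i - (\<Sum>k<i. of_bool (walk_sphere_in G k i v \<noteq> {}) * int d ^ k)"
    unfolding G using v assms(7) by (rule W.card_dist_sphere)
  ultimately show ?thesis
    by (intro conjI exI[of _ "\<lambda>k. of_bool (walk_sphere_in G k i v \<noteq> {})"]) auto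
qed

end
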